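(* Let $R$ be an irreducible, reduced root system with root lattice $Q(R)$ and Weyl group $W_R$. Let $x\in Q(R)$, let $O_x=\{wx : w\in W_R\}$, and let $\operatorname{Conv}(O_x)$ be the convex hull of $O_x$ in $Q(R)\otimes_{\mathbb{Z}}\mathbb{R}$. Let $\alpha\in R$ be a root with corresponding coroot $\alpha^\vee$. Suppose that $y\in \operatorname{Conv}(O_x)$ satisfies $\langle y,\alpha^\vee\rangle=0$ and that $z=y+\tfrac12\alpha$ lies in $Q(R)$. Then $z\in\operatorname{Conv}(O_x)$.
   Context: Root-system terminology is that of Bourbaki. The root lattice $Q(R)$ is the $\mathbb{Z}$-span of $R$; $\langle\cdot,\cdot\rangle$ is the standard pairing between $Q(R)\otimes_{\mathbb{Z}}\mathbb{R}$ and its dual space, in which coroots live, so that $\langle\alpha,\alpha^\vee\rangle=2$. Note that $y$ is a point of $Q(R)\otimes_{\mathbb{Z}}\mathbb{R}$, not necessarily of $Q(R)$. *)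

theory Defs
  imports "HOL-Analysis.Convex"
begin

text \<open>
  A root system (Bourbaki, Lie VI.1) is given by its set of roots \<open>R\<close> inside an ambient real vector
  space. The space \<open>V\<close> in which it lives is \<open>span R\<close>, which is also the realisation of
  \<open>Q(R) \<otimes> \<real>\<close>. An element of the dual of \<open>V\<close> is represented by a linear functional on the ambient
  type (every functional on \<open>span R\<close> extends to one); only its values on \<open>span R\<close> are relevant.
\<close>

definition reflection :: "'a::real_vector \<Rightarrow> ('a \<Rightarrow> real) \<Rightarrow> 'a \<Rightarrow> 'a" where
  "reflection \<alpha> f v = v - f v *\<^sub>R \<alpha>"

definition is_coroot :: "'a::real_vector set \<Rightarrow> 'a \<Rightarrow> ('a \<Rightarrow> real) \<Rightarrow> bool" where
  "is_coroot R \<alpha> f \<longleftrightarrow> linear f \<and> f \<alpha> = 2 \<and> reflection \<alpha> f ` R \<subseteq> R"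

lemma is_coroot_unique:
  assumes "finite R" and f: "is_coroot R \<alpha> f" and g: "is_coroot R \<alpha> g" and "v \<in> span R"
  shows "f v = g v"
proof -
  have lf: "linear f" and lg: "linear g" and fa: "f \<alpha> = 2" and ga: "g \<alpha> = 2"
    using f g by (auto simp: is_coroot_def)
  have a0: "\<alpha> \<noteq> 0"
    using fa linear_0[OF lf] by auto
  have on_R: "f b = g b" if b: "b \<in> R" for b
  proof (rule ccontr)
    assume ne: "f b \<noteq> g b"
    define c where "c = g b - f b"
    have mem: "b - (real n * c) *\<^sub>R \<alpha> \<in> R" for n
    proof (induction n)
      case 0
      then show ?case using b by simp
    next
      case (Suc n)
      define u where "u = b - (real n * c) *\<^sub>R \<alpha>"
      have "g u - f u = c"
        by (simp add: u_def c_def linear_diff[OF lf] linear_diff[OF lg] linear_scale[OF lf]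
            linear_scale[OF lg] fa ga)
      moreover have "reflection \<alpha> g (reflection \<alpha> f u) = u - (g u - f u) *\<^sub>R \<alpha>"
        by (simp add: reflection_def linear_diff[OF lg] linear_scale[OF lg] ga algebra_simps
            flip: scaleR_add_left)
      moreover have "reflection \<alpha> g (reflection \<alpha> f u) \<in> R"
        using f g Suc unfolding is_coroot_def u_def by blast
      ultimately have "u - c *\<^sub>R \<alpha> \<in> R"
        by simp
      then show ?case
        by (simp add: u_def algebra_simps)
    qed
    have "inj (\<lambda>n. b - (real n * c) *\<^sub>R \<alpha>)"
      using ne a0 by (auto simp: inj_def c_def)
    moreover have "finite (range (\<lambda>n. b - (real n * c) *\<^sub>R \<alpha>))"
      using mem by (intro finite_subset[OF _ \<open>finite R\<close>]) auto
    ultimately show False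
      using finite_imageD by fastforce
  qed
  show ?thesis
    using linear_eq_on_span[OF lf lg on_R] \<open>v \<in> span R\<close> by blast
qed

text \<open>
  By the preceding lemma the restriction of \<open>coroot R \<alpha>\<close> to \<open>span R\<close> does not depend on the choice.
\<close>

definition coroot :: "'a::real_vector set \<Rightarrow> 'a \<Rightarrow> 'a \<Rightarrow> real" where
  "coroot R \<alpha> = (SOME f. is_coroot R \<alpha> f)"

definition root_system :: "'a::real_vector set \<Rightarrow> bool" where
  "root_system R \<longleftrightarrow>
     finite R \<and> 0 \<notin> R \<and>
     (\<forall>\<alpha>\<in>R. \<exists>f. is_coroot R \<alpha> f) \<and>
     (\<forall>\<alpha>\<in>R. \<forall>\<beta>\<in>R. coroot R \<alpha> \<beta> \<in> \<int>)"

text \<open>Bourbaki: every root \<open>\<alpha>\<close> is indivisible, i.e. \<open>\<alpha>/2\<close> is not a root.\<close>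

definition reduced :: "'a::real_vector set \<Rightarrow> bool" where
  "reduced R \<longleftrightarrow> (\<forall>\<alpha>\<in>R. (1/2) *\<^sub>R \<alpha> \<notin> R)"

text \<open>
  \<open>R\<close> is the direct sum of \<open>R\<^sub>1\<close> and \<open>R\<^sub>2\<close>: the sum of the spaces \<open>span R\<^sub>1\<close> and \<open>span R\<^sub>2\<close> is
  automatically \<open>span R\<close>, so only its directness has to be demanded.
\<close>

definition root_system_direct_sum ::
    "'a::real_vector set \<Rightarrow> 'a set \<Rightarrow> 'a set \<Rightarrow> bool" where
  "root_system_direct_sum R R\<^sub>1 R\<^sub>2 \<longleftrightarrow>
     root_system R\<^sub>1 \<and> root_system R\<^sub>2 \<and> R = R\<^sub>1 \<union> R\<^sub>2 \<and> span R\<^sub>1 \<inter> span R\<^sub>2 = {0}"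

definition irreducible_root_system :: "'a::real_vector set \<Rightarrow> bool" where
  "irreducible_root_system R \<longleftrightarrow>
     root_system R \<and> R \<noteq> {} \<and>
     \<not> (\<exists>R\<^sub>1 R\<^sub>2. R\<^sub>1 \<noteq> {} \<and> R\<^sub>2 \<noteq> {} \<and> root_system_direct_sum R R\<^sub>1 R\<^sub>2)"

definition root_lattice :: "'a::real_vector set \<Rightarrow> 'a set" where
  "root_lattice R = {\<Sum>\<alpha>\<in>R. of_int (c \<alpha>) *\<^sub>R \<alpha> | c :: 'a \<Rightarrow> int. True}"

text \<open>
  Reflections are involutions, so closing under composition already yields the generated group.
  Elements are maps on the ambient space; as with \<open>coroot\<close>, their action on \<open>span R\<close> is the
  relevant (and choice-independent) one.
\<close>

inductive_set weyl_group :: "'a::real_vector set \<Rightarrow> ('a \<Rightarrow> 'a) set" for R where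
  "id \<in> weyl_group R"
| "\<alpha> \<in> R \<Longrightarrow> w \<in> weyl_group R \<Longrightarrow> reflection \<alpha> (coroot R \<alpha>) \<circ> w \<in> weyl_group R"

definition weyl_orbit :: "'a::real_vector set \<Rightarrow> 'a \<Rightarrow> 'a set" where
  "weyl_orbit R x = {w x | w. w \<in> weyl_group R}"

end

theory Submission
  imports Defs
begin

text \<open>
  Perturb the functional \<open>(z, \<cdot>)\<close> to a generic one; for the resulting positive system \<open>z\<close> is dominant
  and \<open>\<alpha>\<close> is positive, since \<open>\<langle>z, \<alpha>\<^sup>\<or>\<rangle> = 1\<close>. Let \<open>X\<close> be a dominant element of the orbit and write
  \<open>X - z = p - n\<close>, where \<open>p\<close> and \<open>n\<close> are nonnegative integral combinations of disjoint sets of simple roots,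
  so that \<open>(p, n) \<le> 0\<close>. As \<open>X - y = X - z + \<alpha>/2\<close> has nonnegative coefficients, \<open>n \<le> \<alpha>/2\<close>
  coefficientwise, whence, by dominance of \<open>X\<close> and \<open>z\<close>,
  \<open>(n, n) = (p, n) - (X, n) + (z, n) \<le> (z, n) \<le> (z, \<alpha>)/2 = (\<alpha>, \<alpha>)/4\<close>.
  A nonzero element of the root lattice is at least as long as the shortest root, and in an irreducible
  reduced system \<open>(\<alpha>, \<alpha>) \<le> 3(\<beta>, \<beta>)\<close> for all roots \<open>\<beta>\<close>. Hence \<open>n = 0\<close>, that is \<open>z \<le> X\<close>, and subtracting
  simple roots one at a time leads from \<open>X\<close> to \<open>z\<close> inside the convex hull.
\<close>

section \<open>Reflections, coroots, an invariant form and generic functionals\<close>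

lemma reflection_linear: "linear f \<Longrightarrow> linear (reflection \<alpha> f)"
  unfolding reflection_def
  by (intro linearI) (auto simp: linear_add linear_scale algebra_simps)

lemma reflection_involution:
  assumes "linear f" "f \<alpha> = 2"
  shows "reflection \<alpha> f (reflection \<alpha> f v) = v"
  using assms by (simp add: reflection_def linear_diff linear_scale algebra_simps)

lemma coroot_is_coroot:
  assumes "root_system R" "\<alpha> \<in> R"
  shows "is_coroot R \<alpha> (coroot R \<alpha>)"
  using assms unfolding root_system_def coroot_def by (metis someI_ex)

text \<open>The coroots of \<open>R\<close> restrict to coroots of \<open>A\<close>, and
  \<open>is_coroot_unique\<close> on \<open>span A\<close> identifies them with those chosen for
  \<open>A\<close>, so integrality is inherited.\<close>

lemma root_system_subset:
  assumes R: "root_system R" and "A \<subseteq> R"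
    and refl: "\<And>\<alpha> \<beta>. \<alpha> \<in> A \<Longrightarrow> \<beta> \<in> A \<Longrightarrow> reflection \<alpha> (coroot R \<alpha>) \<beta> \<in> A"
  shows "root_system A"
proof -
  have finA: "finite A"
    using R \<open>A \<subseteq> R\<close> finite_subset by (auto simp: root_system_def)
  have c: "is_coroot A \<alpha> (coroot R \<alpha>)" if "\<alpha> \<in> A" for \<alpha>
    using coroot_is_coroot[OF R, of \<alpha>] that refl \<open>A \<subseteq> R\<close> by (auto simp: is_coroot_def)
  have cA: "is_coroot A \<alpha> (coroot A \<alpha>)" if "\<alpha> \<in> A" for \<alpha>
    using c[OF that] unfolding coroot_def by (metis someI_ex)
  have "coroot A \<alpha> \<beta> = coroot R \<alpha> \<beta>" if "\<alpha> \<in> A" "\<beta> \<in> A" for \<alpha> \<beta>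
    using is_coroot_unique[OF finA cA c] that span_base by blast
  then show ?thesis
    using R \<open>A \<subseteq> R\<close> finA c unfolding root_system_def by (metis subsetD)
qed

text \<open>
  The form sums the squares of a finite set of functionals that separates the points of the span.
  This set is stable under the reflections because it is cut out by a condition on the values on
  \<open>R\<close>, so no averaging over the Weyl group (which need not be finite on the ambient space) occurs.
\<close>

lemma invariant_form_exists:
  fixes R :: "'a::real_vector set"
  assumes R: "root_system R"
  obtains B :: "'a \<Rightarrow> 'a \<Rightarrow> real" where
    "\<And>u v. B u v = B v u" "\<And>u. linear (B u)"
    "\<And>v. v \<in> span R \<Longrightarrow> v \<noteq> 0 \<Longrightarrow> 0 < B v v"
    "\<And>\<beta> u v. \<beta> \<in> R \<Longrightarrow> u \<in> span R \<Longrightarrow> v \<in> span R \<Longrightarrow>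
       B (reflection \<beta> (coroot R \<beta>) u) (reflection \<beta> (coroot R \<beta>) v) = B u v"
proof -
  have finR: "finite R"
    using R by (auto simp: root_system_def)
  obtain b where b: "b \<subseteq> R" "independent b" "R \<subseteq> span b"
    using maximal_independent_subset by blast
  have finb: "finite b"
    using b finR finite_subset by blast
  have spb: "span b = span R"
    by (metis b(1,3) span_mono span_span subset_antisym)
  have "\<forall>h :: 'a \<Rightarrow> real. \<exists>g. linear g \<and> (\<forall>i\<in>b. g i = h i)"
    using linear_independent_extend[OF b(2)] by blast
  then obtain G :: "('a \<Rightarrow> real) \<Rightarrow> 'a \<Rightarrow> real"
    where lG: "\<And>h. linear (G h)" and G: "\<And>h i. i \<in> b \<Longrightarrow> G h i = h i"
    by metis
  define S where "S = (\<lambda>(\<beta>, i). representation b \<beta> i) ` (R \<times> b)"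
  \<comment> \<open>Functionals are encoded by their values on the basis \<open>b\<close>. Since
    \<open>S\<close>, the set of root coordinates, is finite, so is \<open>H\<close>; extensionality
    makes the encoding unique.\<close>
  define H where "H = {h \<in> b \<rightarrow>\<^sub>E S. \<forall>\<beta>\<in>R. G h \<beta> \<in> S}"
  have finH: "finite H"
    unfolding H_def S_def using finR finb by (simp add: finite_PiE)
  define B where "B u v = (\<Sum>h\<in>H. G h u * G h v)" for u v
  have "0 < B v v" if v: "v \<in> span R" "v \<noteq> 0" for v
  proof -
    \<comment> \<open>The coordinate functionals belong to \<open>H\<close>, and they already
      separate the points of \<open>span R\<close>.\<close>
    define h where "h i = restrict (\<lambda>j. if j = i then 1 else 0 :: real) b" for i
    have Gh: "G (h i) u = representation b u i" if "i \<in> b" "u \<in> span R" for i u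
    proof -
      have "u = (\<Sum>j\<in>b. representation b u j *\<^sub>R j)"
        using sum_representation_eq[OF b(2), of u b] that spb finb by simp
      then have "G (h i) u = G (h i) (\<Sum>j\<in>b. representation b u j *\<^sub>R j)"
        by simp
      also have "\<dots> = (\<Sum>j\<in>b. representation b u j * G (h i) j)"
        by (simp add: linear_sum[OF lG] linear_scale[OF lG])
      also have "\<dots> = (\<Sum>j\<in>b. if j = i then representation b u j else 0)"
        by (intro sum.cong) (auto simp: G h_def)
      finally show ?thesis
        using that finb by simp
    qed
    have hH: "h i \<in> H" if i: "i \<in> b" for i
    proof -
      have S: "G (h i) \<beta> \<in> S" if "\<beta> \<in> R" for \<beta>
        using Gh[OF i span_base[OF that]] that i by (auto simp: S_def)
      moreover have "h i j \<in> S" if "j \<in> b" for j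
        using S[of j] G[of j "h i"] that b by auto
      ultimately show ?thesis
        by (auto simp: H_def h_def)
    qed
    obtain i where "i \<in> b" "representation b v i \<noteq> 0"
      using sum_representation_eq[OF b(2), of v b] v spb finb
      by (metis (no_types, lifting) order_refl scale_zero_left sum.neutral)
    then have "h i \<in> H" "G (h i) v * G (h i) v > 0"
      using hH Gh v by (auto simp: zero_less_mult_iff)
    then show ?thesis
      unfolding B_def by (intro sum_pos2[OF finH, of "h i"]) auto
  qed
  moreover have "B (reflection \<beta> (coroot R \<beta>) u) (reflection \<beta> (coroot R \<beta>) v) = B u v"
    if \<beta>: "\<beta> \<in> R" and uv: "u \<in> span R" "v \<in> span R" for \<beta> u v
  proof -
    let ?s = "reflection \<beta> (coroot R \<beta>)"
    have c: "linear (coroot R \<beta>)" "coroot R \<beta> \<beta> = 2" "?s ` R \<subseteq> R"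
      using coroot_is_coroot[OF R \<beta>] by (auto simp: is_coroot_def)
    have ls: "linear ?s"
      using c by (simp add: reflection_linear)
    have ss: "?s (?s w) = w" for w
      using c by (simp add: reflection_involution)
    \<comment> \<open>Precomposition with the reflection, in the encoding by values on
      \<open>b\<close>. It is an involution of \<open>H\<close>, so it only permutes the summands of
      \<open>B\<close>.\<close>
    define \<sigma> where "\<sigma> h = restrict (\<lambda>i. G h (?s i)) b" for h
    have Gs: "G (\<sigma> h) w = G h (?s w)" if "w \<in> span R" for h w
    proof (rule linear_eq_on_span[OF lG _ _ that[folded spb]])
      show "linear (\<lambda>w. G h (?s w))"
        using linear_compose[OF ls lG] by (simp add: o_def)
      show "G (\<sigma> h) i = G h (?s i)" if "i \<in> b" for i
        using that G by (simp add: \<sigma>_def)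
    qed
    have \<sigma>H: "\<sigma> h \<in> H" if "h \<in> H" for h
    proof -
      have "G (\<sigma> h) \<gamma> \<in> S" if "\<gamma> \<in> R" for \<gamma>
        using Gs[OF span_base[OF that]] that \<open>h \<in> H\<close> c by (auto simp: H_def)
      moreover have "\<sigma> h i \<in> S" if "i \<in> b" for i
      proof -
        have "?s i \<in> R" using that b c by blast
        then show ?thesis using that \<open>h \<in> H\<close> by (auto simp: H_def \<sigma>_def)
      qed
      ultimately show ?thesis
        by (auto simp: H_def \<sigma>_def)
    qed
    have \<sigma>\<sigma>: "\<sigma> (\<sigma> h) = h" if "h \<in> H" for h
    proof
      fix i
      show "\<sigma> (\<sigma> h) i = h i"
      proof (cases "i \<in> b")
        case True
        then have "?s i \<in> span R"
          using b c by (intro span_base) auto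
        then show ?thesis
          using True Gs ss G by (simp add: \<sigma>_def[of "\<sigma> h"])
      next
        case False
        then show ?thesis
          using that by (auto simp: \<sigma>_def H_def PiE_def extensional_def)
      qed
    qed
    show ?thesis
      unfolding B_def
      by (rule sum.reindex_bij_witness[of _ \<sigma> \<sigma>]) (auto simp: \<sigma>H \<sigma>\<sigma> Gs uv)
  qed
  moreover have "linear (B u)" for u
    unfolding B_def
    by (intro linearI)
      (simp_all add: linear_add[OF lG] linear_scale[OF lG] algebra_simps sum.distrib sum_distrib_left)
  moreover have "B u v = B v u" for u v
    unfolding B_def by (simp add: mult.commute)
  ultimately show thesis
    using that by blast
qed

text \<open>One point at a time: if \<open>\<phi>\<close> vanishes at the new point, a multiple of a
  functional that does not vanish there is added, so small that no nonzero value of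
  \<open>\<phi>\<close> on \<open>A\<close> changes its sign.\<close>

lemma generic_functional:
  fixes g :: "'a::real_vector \<Rightarrow> real"
  assumes "finite A" "linear g" and sep: "\<And>a. a \<in> A \<Longrightarrow> \<exists>f :: 'a \<Rightarrow> real. linear f \<and> f a \<noteq> 0"
  obtains \<phi> :: "'a \<Rightarrow> real" where "linear \<phi>" "\<And>a. a \<in> A \<Longrightarrow> \<phi> a \<noteq> 0" "\<And>a. a \<in> A \<Longrightarrow> g a > 0 \<Longrightarrow> \<phi> a > 0"
proof -
  have "\<exists>\<phi> :: 'a \<Rightarrow> real. linear \<phi> \<and> (\<forall>a\<in>F. \<phi> a \<noteq> 0) \<and> (\<forall>a\<in>A. g a > 0 \<longrightarrow> \<phi> a > 0)"
    if "finite F" "F \<subseteq> A" for F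
    using that
  proof (induction F)
    case empty
    then show ?case using \<open>linear g\<close> by auto
  next
    case (insert b F)
    then obtain \<phi> :: "'a \<Rightarrow> real" where \<phi>: "linear \<phi>" "\<And>a. a \<in> F \<Longrightarrow> \<phi> a \<noteq> 0"
      "\<And>a. a \<in> A \<Longrightarrow> g a > 0 \<Longrightarrow> \<phi> a > 0"
      by auto
    obtain f :: "'a \<Rightarrow> real" where f: "linear f" "f b \<noteq> 0"
      using sep insert.prems by auto
    show ?case
    proof (cases "\<phi> b = 0")
      case False
      then show ?thesis using \<phi> by auto
    next
      case True
      have "\<exists>\<epsilon>>0. \<forall>a\<in>A. \<phi> a \<noteq> 0 \<longrightarrow> \<epsilon> * \<bar>f a\<bar> < \<bar>\<phi> a\<bar>"
        using \<open>finite A\<close>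
      proof (induction A)
        case empty
        then show ?case by (auto intro: exI[of _ 1])
      next
        case (insert a A)
        then obtain \<epsilon> where e: "\<epsilon> > 0" "\<And>a. a \<in> A \<Longrightarrow> \<phi> a \<noteq> 0 \<Longrightarrow> \<epsilon> * \<bar>f a\<bar> < \<bar>\<phi> a\<bar>"
          by blast
        show ?case
        proof (cases "\<phi> a = 0")
          case True
          then show ?thesis using e by auto
        next
          case False
          \<comment> \<open>The \<open>+ 1\<close> avoids a zero denominator and makes the bound at
            \<open>a\<close> strict.\<close>
          define \<delta> where "\<delta> = \<bar>\<phi> a\<bar> / (\<bar>f a\<bar> + 1)"
          have d: "\<delta> > 0" using False by (auto simp: \<delta>_def intro!: divide_pos_pos)
          have da: "\<delta> * (\<bar>f a\<bar> + 1) = \<bar>\<phi> a\<bar>"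
            by (simp add: \<delta>_def)
          have "min \<epsilon> \<delta> * \<bar>f c\<bar> < \<bar>\<phi> c\<bar>" if "c \<in> insert a A" "\<phi> c \<noteq> 0" for c
          proof (cases "c = a")
            case True
            have "min \<epsilon> \<delta> * \<bar>f a\<bar> \<le> \<delta> * \<bar>f a\<bar>"
              by (intro mult_right_mono) auto
            then show ?thesis using True d da by (simp add: algebra_simps)
          next
            case False
            have "min \<epsilon> \<delta> * \<bar>f c\<bar> \<le> \<epsilon> * \<bar>f c\<bar>"
              by (intro mult_right_mono) auto
            then show ?thesis using False that e(2)[of c] by auto
          qed
          then show ?thesis using d e by (intro exI[of _ "min \<epsilon> \<delta>"]) auto
        qed
      qed
      then obtain \<epsilon> where e: "\<epsilon> > 0" "\<And>a. a \<in> A \<Longrightarrow> \<phi> a \<noteq> 0 \<Longrightarrow> \<epsilon> * \<bar>f a\<bar> < \<bar>\<phi> a\<bar>"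
        by blast
      define \<psi> where "\<psi> a = \<phi> a + \<epsilon> * f a" for a
      have "linear \<psi>"
        unfolding \<psi>_def using \<phi>(1) f(1)
        by (intro linearI) (auto simp: linear_add linear_scale algebra_simps)
      moreover have near: "\<bar>\<psi> a - \<phi> a\<bar> < \<bar>\<phi> a\<bar>" if "a \<in> A" "\<phi> a \<noteq> 0" for a
        using e that by (simp add: \<psi>_def abs_mult)
      have "\<psi> a \<noteq> 0" if "a \<in> insert b F" for a
      proof (cases "a = b")
        case True
        then show ?thesis using \<open>\<phi> b = 0\<close> f e by (simp add: \<psi>_def)
      next
        case False
        then show ?thesis using near[of a] \<phi>(2)[of a] that insert.prems by auto
      qed
      moreover have "\<psi> a > 0" if "a \<in> A" "g a > 0" for a
        using near[of a] \<phi>(3)[of a] that by linarith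
      ultimately show ?thesis by blast
    qed
  qed
  from this[OF assms(1)] show thesis using that by auto
qed

subsection \<open>The invariant form\<close>

text \<open>Positivity and invariance are confined to \<open>span R\<close>: off it, the chosen
  coroots are arbitrary and the constructed form may be degenerate.\<close>

locale root_form =
  fixes R :: "'a::real_vector set" and B :: "'a \<Rightarrow> 'a \<Rightarrow> real"
  assumes root_system: "root_system R"
    and sym: "B u v = B v u"
    and lin: "linear (B u)"
    and pos: "v \<in> span R \<Longrightarrow> v \<noteq> 0 \<Longrightarrow> 0 < B v v"
    and inv: "\<beta> \<in> R \<Longrightarrow> u \<in> span R \<Longrightarrow> v \<in> span R \<Longrightarrow>
       B (reflection \<beta> (coroot R \<beta>) u) (reflection \<beta> (coroot R \<beta>) v) = B u v"
begin

abbreviation s where "s \<beta> \<equiv> reflection \<beta> (coroot R \<beta>)"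

lemma lin_left: "linear (\<lambda>u. B u v)"
proof -
  have "(\<lambda>u. B u v) = B v" by (rule ext) (rule sym)
  then show ?thesis using lin by simp
qed

lemmas form_simps =
  linear_add[OF lin] linear_diff[OF lin] linear_neg[OF lin] linear_0[OF lin] linear_scale[OF lin]
  linear_add[OF lin_left] linear_diff[OF lin_left] linear_neg[OF lin_left] linear_0[OF lin_left]
  linear_scale[OF lin_left] real_scaleR_def

lemmas form_sum = linear_sum[OF lin] linear_sum[OF lin_left]

lemma finite_roots: "finite R"
  and coroot_linear: "\<beta> \<in> R \<Longrightarrow> linear (coroot R \<beta>)"
  and coroot_self: "\<beta> \<in> R \<Longrightarrow> coroot R \<beta> \<beta> = 2"
  and s_root: "\<beta> \<in> R \<Longrightarrow> \<gamma> \<in> R \<Longrightarrow> s \<beta> \<gamma> \<in> R"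
  and coroot_int: "\<beta> \<in> R \<Longrightarrow> \<gamma> \<in> R \<Longrightarrow> coroot R \<beta> \<gamma> \<in> \<int>"
  and root_nonzero: "\<beta> \<in> R \<Longrightarrow> \<beta> \<noteq> 0"
  using root_system coroot_is_coroot[OF root_system, of \<beta>]
  by (auto simp: root_system_def is_coroot_def)

lemma s_linear: "\<beta> \<in> R \<Longrightarrow> linear (s \<beta>)"
  by (simp add: reflection_linear coroot_linear)

lemma s_s: "\<beta> \<in> R \<Longrightarrow> s \<beta> (s \<beta> v) = v"
  by (simp add: reflection_involution coroot_linear coroot_self)

lemma s_span: "\<beta> \<in> R \<Longrightarrow> v \<in> span R \<Longrightarrow> s \<beta> v \<in> span R"
  by (simp add: reflection_def span_base span_diff span_scale)

lemma s_self: "\<beta> \<in> R \<Longrightarrow> s \<beta> \<beta> = - \<beta>"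
  by (simp add: reflection_def coroot_self scaleR_2)

lemma neg_root: "\<beta> \<in> R \<Longrightarrow> - \<beta> \<in> R"
  using s_root[of \<beta> \<beta>] s_self[of \<beta>] by simp

lemma root_pos: "\<beta> \<in> R \<Longrightarrow> B \<beta> \<beta> > 0"
  using pos root_nonzero span_base by blast

text \<open>This is invariance for the pair \<open>u\<close>, \<open>\<beta>\<close>, combined with
  \<open>s \<beta> \<beta> = - \<beta>\<close>.\<close>

lemma coroot_form:
  assumes "\<beta> \<in> R" "u \<in> span R"
  shows "coroot R \<beta> u * B \<beta> \<beta> = 2 * B u \<beta>"
proof -
  have "B (s \<beta> u) (s \<beta> \<beta>) = B u \<beta>"
    using assms inv span_base by blast
  then show ?thesis
    using assms by (simp add: s_self) (simp add: reflection_def form_simps)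
qed

lemma coroot_eq:
  assumes "\<beta> \<in> R" "u \<in> span R"
  shows "coroot R \<beta> u = 2 * B u \<beta> / B \<beta> \<beta>"
  using coroot_form[OF assms] root_pos[OF assms(1)] by (simp add: field_simps)

lemma coroot_s:
  assumes "\<beta> \<in> R" "\<gamma> \<in> R" "u \<in> span R"
  shows "coroot R (s \<gamma> \<beta>) (s \<gamma> u) = coroot R \<beta> u"
  using assms by (simp add: coroot_eq s_root s_span inv span_base)

lemma s_conj:
  assumes "\<beta> \<in> R" "\<gamma> \<in> R" "u \<in> span R"
  shows "s (s \<gamma> \<beta>) (s \<gamma> u) = s \<gamma> (s \<beta> u)"
  using coroot_s[OF assms] s_linear[OF assms(2)]
  by (simp add: reflection_def[of "s \<gamma> \<beta>"] reflection_def[of \<beta>] linear_diff linear_scale)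

text \<open>
  If the bound fails, irreducibility provides a root \<open>\<gamma>\<close> of
  the same length as \<open>\<alpha>\<close> and not orthogonal to \<open>\<beta>\<close>; then \<open>\<gamma> = \<plusminus>2\<beta>\<close>, against reducedness.
\<close>

lemma root_length_ratio:
  assumes irr: "irreducible_root_system R" and red: "reduced R" and \<alpha>: "\<alpha> \<in> R" and \<beta>: "\<beta> \<in> R"
  shows "B \<alpha> \<alpha> \<le> 3 * B \<beta> \<beta>"
proof -
  \<comment> \<open>\<open>R2\<close> consists of the roots orthogonal to all roots as long as
    \<open>\<alpha>\<close>. Both \<open>R1\<close> and \<open>R2\<close> turn out to be root
    systems, with spans meeting only in 0, so irreducibility leaves \<open>R2\<close> empty.\<close>
  define T where "T = {\<gamma> \<in> R. B \<gamma> \<gamma> = B \<alpha> \<alpha>}"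
  define R2 where "R2 = {\<delta> \<in> R. \<forall>\<gamma>\<in>T. B \<delta> \<gamma> = 0}"
  define R1 where "R1 = R - R2"
  have TR: "T \<subseteq> R" by (auto simp: T_def)
  have orth: "B u t = 0" if "u \<in> span R2" "t \<in> span T" for u t
  proof -
    have "B u \<gamma> = 0" if "\<gamma> \<in> T" for \<gamma>
      using linear_eq_0_on_span[OF lin_left _ \<open>u \<in> span R2\<close>, of \<gamma>] that by (auto simp: R2_def)
    then show ?thesis
      using linear_eq_0_on_span[OF lin _ \<open>t \<in> span T\<close>, of u] by auto
  qed
  have R1T: "\<delta> \<in> span T" if \<delta>: "\<delta> \<in> R1" for \<delta>
  proof -
    obtain \<gamma> where g: "\<gamma> \<in> T" "B \<delta> \<gamma> \<noteq> 0" and dR: "\<delta> \<in> R"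
      using \<delta> by (auto simp: R1_def R2_def)
    have gR: "\<gamma> \<in> R" using g TR by auto
    have c: "coroot R \<delta> \<gamma> \<noteq> 0"
      using coroot_form[OF dR span_base[OF gR]] g sym[of \<gamma> \<delta>] by auto
    have "s \<delta> \<gamma> \<in> T"
      using g dR gR by (auto simp: T_def s_root inv span_base)
    \<comment> \<open>The difference is a nonzero multiple of \<open>\<delta>\<close>, while both of
      its terms lie in \<open>T\<close>.\<close>
    then have "\<gamma> - s \<delta> \<gamma> \<in> span T"
      using g by (intro span_diff span_base)
    then have "coroot R \<delta> \<gamma> *\<^sub>R \<delta> \<in> span T"
      by (simp add: reflection_def)
    then show ?thesis using c
      by (metis span_scale scaleR_scaleR left_inverse scaleR_one)
  qed
  have "root_system R2"
    using TR by (intro root_system_subset[OF root_system])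
      (auto simp: R2_def s_root, simp add: reflection_def form_simps)
  moreover have "root_system R1"
  proof (intro root_system_subset[OF root_system])
    fix \<gamma> \<delta> assume gd: "\<gamma> \<in> R1" "\<delta> \<in> R1"
    then have R: "\<gamma> \<in> R" "\<delta> \<in> R" "s \<gamma> \<delta> \<in> R" by (auto simp: R1_def s_root)
    show "s \<gamma> \<delta> \<in> R1"
    proof (rule ccontr)
      assume "s \<gamma> \<delta> \<notin> R1"
      then have R2: "s \<gamma> \<delta> \<in> R2" using R by (simp add: R1_def)
      then have "B (s \<gamma> \<delta>) \<gamma> = 0"
        using orth[OF span_base R1T] gd by blast
      then have "coroot R \<gamma> (s \<gamma> \<delta>) = 0"
        using R by (simp add: coroot_eq span_base)
      then have "s \<gamma> (s \<gamma> \<delta>) = s \<gamma> \<delta>"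
        by (simp add: reflection_def)
      then have "\<delta> \<in> R2" using R2 s_s R by simp
      then show False using gd by (simp add: R1_def)
    qed
  qed (auto simp: R1_def)
  moreover have "span R1 \<inter> span R2 = {0}"
  proof -
    have "v = 0" if v: "v \<in> span R1" "v \<in> span R2" for v
    proof (rule ccontr)
      assume "v \<noteq> 0"
      have "v \<in> span T"
        using v R1T by (metis span_mono span_span subsetI subsetD)
      then have "B v v = 0" using orth v by blast
      moreover have "v \<in> span R"
        using v span_mono[of R2 R] by (auto simp: R2_def)
      ultimately show False using pos \<open>v \<noteq> 0\<close> by fastforce
    qed
    then show ?thesis using span_zero by blast
  qed
  moreover have "\<alpha> \<in> R1"
    using \<alpha> root_pos[OF \<alpha>] by (auto simp: R1_def R2_def T_def)
  moreover have "R = R1 \<union> R2"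
    by (auto simp: R1_def R2_def)
  ultimately have "R2 = {}"
    using irr unfolding irreducible_root_system_def root_system_direct_sum_def by blast
  then obtain \<gamma> where \<gamma>: "\<gamma> \<in> R" "B \<gamma> \<gamma> = B \<alpha> \<alpha>" "B \<beta> \<gamma> \<noteq> 0"
    using \<beta> by (auto simp: R2_def T_def)
  define \<sigma> :: real where "\<sigma> = sgn (B \<beta> \<gamma>)"
  have \<sigma>: "\<sigma> * B \<beta> \<gamma> = \<bar>B \<beta> \<gamma>\<bar>" "\<sigma> * \<sigma> = 1" "\<sigma> = 1 \<or> \<sigma> = - 1"
    using \<gamma>(3) by (auto simp: \<sigma>_def sgn_if)
  have p: "\<bar>coroot R \<beta> \<gamma>\<bar> * B \<beta> \<beta> = 2 * \<bar>B \<beta> \<gamma>\<bar>"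
    using coroot_form[OF \<beta> span_base[OF \<gamma>(1)]] root_pos[OF \<beta>] sym[of \<beta> \<gamma>]
    by (metis abs_mult abs_numeral abs_of_pos)
  have q: "\<bar>coroot R \<gamma> \<beta>\<bar> * B \<gamma> \<gamma> = 2 * \<bar>B \<beta> \<gamma>\<bar>"
    using coroot_form[OF \<gamma>(1) span_base[OF \<beta>]] root_pos[OF \<gamma>(1)]
    by (metis abs_mult abs_numeral abs_of_pos)
  obtain m n :: int where mn: "\<bar>coroot R \<beta> \<gamma>\<bar> = real_of_int m" "\<bar>coroot R \<gamma> \<beta>\<bar> = real_of_int n"
    using coroot_int \<beta> \<gamma>(1) by (metis Ints_cases of_int_abs)
  show ?thesis
  proof (rule ccontr)
    assume "\<not> ?thesis"
    then have gt: "B \<gamma> \<gamma> > 3 * B \<beta> \<beta>" using \<gamma> by simp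
    have bp: "B \<beta> \<beta> > 0" "B \<gamma> \<gamma> > 0" using root_pos \<beta> \<gamma>(1) by blast+
    have "real_of_int n * B \<gamma> \<gamma> > 0"
      using q \<gamma>(3) mn by simp
    then have n1: "n \<ge> 1"
      using bp by (simp add: zero_less_mult_iff)
    then have "real_of_int n * B \<gamma> \<gamma> \<ge> B \<gamma> \<gamma>"
      using bp by simp
    then have l1: "2 * \<bar>B \<beta> \<gamma>\<bar> \<ge> B \<gamma> \<gamma>" using q mn by simp
    then have "real_of_int m * B \<beta> \<beta> > 3 * B \<beta> \<beta>"
      using p mn gt by simp
    then have "m \<ge> 4" using bp by simp
    then have "real_of_int m * B \<beta> \<beta> \<ge> 4 * B \<beta> \<beta>"
      using bp by (intro mult_right_mono) auto
    then have l2: "2 * \<bar>B \<beta> \<gamma>\<bar> \<ge> 4 * B \<beta> \<beta>" using p mn by simp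
    \<comment> \<open>Adding \<open>l1\<close> and \<open>l2\<close> gives \<open>B \<gamma>
      \<gamma> + 4 * B \<beta> \<beta> \<le> 4 * \<bar>B \<beta> \<gamma>\<bar>\<close>, so
      \<open>?w\<close> has nonpositive norm.\<close>
    let ?w = "\<gamma> - (2 * \<sigma>) *\<^sub>R \<beta>"
    have "B ?w ?w = B \<gamma> \<gamma> - 4 * (\<sigma> * B \<beta> \<gamma>) + 4 * (\<sigma> * \<sigma>) * B \<beta> \<beta>"
      by (simp add: form_simps sym[of \<gamma> \<beta>] algebra_simps)
    then have "B ?w ?w \<le> 0" using l1 l2 \<sigma> by simp
    then have "?w = 0"
      using pos[of ?w] \<beta> \<gamma> by (metis linorder_not_le span_base span_diff span_scale)
    then have "\<gamma> = (2 * \<sigma>) *\<^sub>R \<beta>" by simp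
    then have "\<beta> = (1/2) *\<^sub>R (\<sigma> *\<^sub>R \<gamma>)" using \<sigma>(2) by (simp add: mult.commute)
    moreover have "\<sigma> *\<^sub>R \<gamma> \<in> R" using \<sigma>(3) \<gamma>(1) neg_root by auto
    ultimately show False using red \<beta> by (auto simp: reduced_def)
  qed
qed

text \<open>If one of the two Cartan integers is 1, a single reflection yields the difference up to
  sign. If both are at least 2, the difference has nonpositive norm and so vanishes.\<close>

lemma root_diff:
  assumes "\<alpha> \<in> R" "\<beta> \<in> R" "\<alpha> \<noteq> \<beta>" "B \<alpha> \<beta> > 0"
  shows "\<alpha> - \<beta> \<in> R"
proof -
  obtain m n :: int where mn: "coroot R \<beta> \<alpha> = real_of_int m" "coroot R \<alpha> \<beta> = real_of_int n"
    using coroot_int assms by (meson Ints_cases)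
  have f: "real_of_int m * B \<beta> \<beta> = 2 * B \<alpha> \<beta>" "real_of_int n * B \<alpha> \<alpha> = 2 * B \<alpha> \<beta>"
    using coroot_form assms mn sym[of \<alpha> \<beta>] by (metis span_base)+
  have bp: "B \<alpha> \<alpha> > 0" "B \<beta> \<beta> > 0" using root_pos assms by auto
  have mn1: "m \<ge> 1" "n \<ge> 1"
    using f bp assms(4) by (smt (verit) mult_nonneg_nonneg mult_nonpos_nonneg of_int_le_0_iff)+
  consider "m = 1" | "n = 1" | "m \<ge> 2" "n \<ge> 2" using mn1 by linarith
  then show ?thesis
  proof cases
    case 1
    then show ?thesis using s_root[of \<beta> \<alpha>] assms mn by (simp add: reflection_def)
  next
    case 2
    then have "\<beta> - \<alpha> \<in> R" using s_root[of \<alpha> \<beta>] assms mn by (simp add: reflection_def)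
    then show ?thesis using neg_root by fastforce
  next
    case 3
    have "2 * B \<beta> \<beta> \<le> real_of_int m * B \<beta> \<beta>" "2 * B \<alpha> \<alpha> \<le> real_of_int n * B \<alpha> \<alpha>"
      using 3 bp by (intro mult_right_mono; simp)+
    then have "B (\<alpha> - \<beta>) (\<alpha> - \<beta>) \<le> 0"
      using f sym[of \<alpha> \<beta>] by (simp add: form_simps)
    then have "\<alpha> - \<beta> = 0"
      using pos[of "\<alpha> - \<beta>"] assms by (metis linorder_not_le span_base span_diff)
    then show ?thesis using assms by simp
  qed
qed

end

subsection \<open>Simple roots and the root lattice\<close>

locale simple_system = root_form +
  fixes \<phi> :: "'a \<Rightarrow> real"
  assumes \<phi>_linear: "linear \<phi>"
    and \<phi>_nonzero: "\<beta> \<in> R \<Longrightarrow> \<phi> \<beta> \<noteq> 0"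
    and red: "reduced R"
begin

definition P where "P = {\<beta> \<in> R. \<phi> \<beta> > 0}"

text \<open>These are the simple roots, taken as the indecomposable positive roots; that they form a
  basis of \<open>span R\<close> follows from \<open>D_independent\<close> and
  \<open>root_expand\<close>.\<close>

definition D where "D = {\<beta> \<in> P. \<forall>\<gamma>\<in>P. \<forall>\<delta>\<in>P. \<beta> \<noteq> \<gamma> + \<delta>}"

definition dominant where "dominant v \<longleftrightarrow> (\<forall>k\<in>D. coroot R k v \<ge> 0)"

lemma P_root: "\<beta> \<in> P \<Longrightarrow> \<beta> \<in> R" and D_P: "k \<in> D \<Longrightarrow> k \<in> P" and D_root: "k \<in> D \<Longrightarrow> k \<in> R"
  and D_span: "k \<in> D \<Longrightarrow> k \<in> span R"
  by (auto simp: P_def D_def span_base)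

lemma finite_P: "finite P" and finite_D: "finite D"
  using finite_roots by (auto simp: P_def D_def)

lemma P_cases: "\<beta> \<in> R \<Longrightarrow> \<beta> \<in> P \<or> - \<beta> \<in> P"
  using \<phi>_nonzero[of \<beta>] neg_root[of \<beta>] by (auto simp: P_def linear_neg[OF \<phi>_linear])

lemma P_neg: "\<beta> \<in> P \<Longrightarrow> - \<beta> \<notin> P"
  by (auto simp: P_def linear_neg[OF \<phi>_linear])

text \<open>\<open>\<phi>\<close> has real values, but \<open>P\<close> is finite, so the number of
  positive roots of smaller value serves as a well-founded measure.\<close>

lemma P_less_induct [consumes 1, case_names less]:
  assumes "\<beta> \<in> P" and step: "\<And>\<beta>. \<beta> \<in> P \<Longrightarrow> (\<And>\<gamma>. \<gamma> \<in> P \<Longrightarrow> \<phi> \<gamma> < \<phi> \<beta> \<Longrightarrow> Q \<gamma>) \<Longrightarrow> Q \<beta>"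
  shows "Q \<beta>"
  using assms(1)
proof (induction "card {\<gamma> \<in> P. \<phi> \<gamma> < \<phi> \<beta>}" arbitrary: \<beta> rule: less_induct)
  case less
  show ?case
  proof (rule step[OF less.prems])
    fix \<gamma> assume g: "\<gamma> \<in> P" "\<phi> \<gamma> < \<phi> \<beta>"
    then have "{\<delta> \<in> P. \<phi> \<delta> < \<phi> \<gamma>} \<subset> {\<delta> \<in> P. \<phi> \<delta> < \<phi> \<beta>}" by auto
    then show "Q \<gamma>"
      using less.hyps g finite_P by (simp add: psubset_card_mono)
  qed
qed

text \<open>Otherwise \<open>k - l\<close> would be a root by \<open>root_diff\<close> and,
  according to its sign, \<open>k\<close> or \<open>l\<close> would be a sum of two positive
  roots.\<close>

lemma D_obtuse:
  assumes "k \<in> D" "l \<in> D" "k \<noteq> l"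
  shows "B k l \<le> 0"
proof (rule ccontr)
  assume "\<not> B k l \<le> 0"
  then have "k - l \<in> R" using root_diff assms D_root by simp
  then consider "k - l \<in> P" | "l - k \<in> P" using P_cases by fastforce
  then show False
  proof cases
    case 1
    then have "k \<noteq> (k - l) + l" using assms D_P unfolding D_def by blast
    then show False by simp
  next
    case 2
    then have "l \<noteq> (l - k) + k" using assms D_P unfolding D_def by blast
    then show False by simp
  qed
qed

text \<open>Diagonal terms vanish because a coefficient and its negative are never both positive;
  the other terms are nonpositive by \<open>D_obtuse\<close>.\<close>

lemma form_parts_nonpos:
  "B (\<Sum>k\<in>D. max 0 (c k) *\<^sub>R k) (\<Sum>k\<in>D. max 0 (- c k) *\<^sub>R k) \<le> 0"
proof -
  have "max 0 (c k) * (max 0 (- c l) * B k l) \<le> 0" if "k \<in> D" "l \<in> D" for k l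
  proof (cases "k = l")
    case True
    then show ?thesis by (auto simp: max_def)
  next
    case False
    then show ?thesis using D_obtuse that by (intro mult_nonneg_nonpos) auto
  qed
  then have "(\<Sum>k\<in>D. \<Sum>l\<in>D. max 0 (c k) * (max 0 (- c l) * B k l)) \<le> 0"
    by (intro sum_nonpos) auto
  moreover have "B (\<Sum>k\<in>D. max 0 (c k) *\<^sub>R k) (\<Sum>k\<in>D. max 0 (- c k) *\<^sub>R k) =
      (\<Sum>k\<in>D. \<Sum>l\<in>D. max 0 (c k) * (max 0 (- c l) * B k l))"
    unfolding linear_sum[OF lin_left]
    by (intro sum.cong refl) (simp add: linear_sum[OF lin] form_simps sum_distrib_left mult.left_commute)
  ultimately show ?thesis by simp
qed

lemma sum_D_span: "(\<Sum>k\<in>D. c k *\<^sub>R k) \<in> span R"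
  by (intro span_sum span_scale D_span)

lemma parts_diff:
  "(\<Sum>k\<in>D. max 0 (c k) *\<^sub>R k) - (\<Sum>k\<in>D. max 0 (- c k) *\<^sub>R k) = (\<Sum>k\<in>D. (c k :: real) *\<^sub>R k)"
  unfolding sum_subtractf[symmetric]
  by (intro sum.cong refl) (auto simp: max_def simp flip: scaleR_diff_left)

text \<open>In a linear relation the positive and the negative part are the same vector, whose norm
  is nonpositive by \<open>form_parts_nonpos\<close>. Hence it is zero, and positivity of
  \<open>\<phi>\<close> on \<open>D\<close> kills its coefficients.\<close>

lemma D_independent: "independent D"
proof (rule independent_if_scalars_zero[OF finite_D])
  have pz: "c k \<le> 0" if c: "(\<Sum>k\<in>D. c k *\<^sub>R k) = 0" and k: "k \<in> D" for c k
  proof -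
    define v where "v = (\<Sum>k\<in>D. max 0 (c k) *\<^sub>R k)"
    have "v = (\<Sum>k\<in>D. max 0 (- c k) *\<^sub>R k)"
      using parts_diff[of c] c by (simp add: v_def)
    then have "B v v \<le> 0"
      using form_parts_nonpos[of c] v_def by simp
    then have "v = 0"
      using pos[of v] sum_D_span v_def by (metis linorder_not_le)
    then have "\<phi> (\<Sum>k\<in>D. max 0 (c k) *\<^sub>R k) = 0"
      using linear_0[OF \<phi>_linear] by (simp add: v_def)
    then have "(\<Sum>k\<in>D. max 0 (c k) * \<phi> k) = 0"
      by (simp add: linear_sum[OF \<phi>_linear] linear_scale[OF \<phi>_linear])
    moreover have "max 0 (c j) * \<phi> j \<ge> 0" if "j \<in> D" for j
      using D_P[OF that] by (auto simp: P_def)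
    ultimately have "max 0 (c k) * \<phi> k = 0"
      using finite_D k by (simp add: sum_nonneg_eq_0_iff)
    then show ?thesis
      using D_P[OF k] by (auto simp: P_def)
  qed
  fix c :: "'a \<Rightarrow> real" and k assume c: "(\<Sum>k\<in>D. c k *\<^sub>R k) = 0" and k: "k \<in> D"
  have "(\<Sum>k\<in>D. (- c k) *\<^sub>R k) = 0" using c by (simp add: sum_negf)
  then show "c k = 0" using pz[OF c k] pz[of "\<lambda>k. - c k", OF _ k] by simp
qed

text \<open>The fundamental coweights; off \<open>span R\<close> they are arbitrary.\<close>

definition om :: "'a \<Rightarrow> 'a \<Rightarrow> real" where
  "om k = (SOME g. linear g \<and> (\<forall>j\<in>D. g j = (if j = k then 1 else 0)))"

lemma om_linear: "linear (om k)" and om_D: "j \<in> D \<Longrightarrow> om k j = (if j = k then 1 else 0)"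
proof -
  have "\<exists>g :: 'a \<Rightarrow> real. linear g \<and> (\<forall>j\<in>D. g j = (if j = k then 1 else 0))"
    using linear_independent_extend[OF D_independent] .
  then have "linear (om k) \<and> (\<forall>j\<in>D. om k j = (if j = k then 1 else 0))"
    unfolding om_def by (rule someI_ex)
  then show "linear (om k)" "j \<in> D \<Longrightarrow> om k j = (if j = k then 1 else 0)" by auto
qed

lemmas om_simps = linear_add[OF om_linear] linear_diff[OF om_linear] linear_neg[OF om_linear]
  linear_0[OF om_linear] linear_scale[OF om_linear]

lemma om_sum: "j \<in> D \<Longrightarrow> om j (\<Sum>k\<in>D. c k *\<^sub>R k) = c j"
proof -
  assume "j \<in> D"
  have "om j (\<Sum>k\<in>D. c k *\<^sub>R k) = (\<Sum>k\<in>D. if k = j then c k else 0)"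
    by (simp add: linear_sum[OF om_linear] om_simps) (intro sum.cong, auto simp: om_D)
  then show ?thesis using \<open>j \<in> D\<close> finite_D by simp
qed

lemma P_span_om: "\<beta> \<in> P \<Longrightarrow> \<beta> \<in> span D \<and> (\<forall>k\<in>D. om k \<beta> \<in> \<int> \<and> om k \<beta> \<ge> 0)"
proof (induction rule: P_less_induct)
  case (less \<beta>)
  show ?case
  proof (cases "\<beta> \<in> D")
    case True
    then show ?thesis by (simp add: span_base om_D)
  next
    case False
    then obtain \<gamma> \<delta> where gd: "\<gamma> \<in> P" "\<delta> \<in> P" "\<beta> = \<gamma> + \<delta>"
      using less.hyps unfolding D_def by blast
    then have "\<phi> \<gamma> < \<phi> \<beta>" "\<phi> \<delta> < \<phi> \<beta>"
      by (auto simp: P_def linear_add[OF \<phi>_linear])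
    then show ?thesis using less.IH gd by (auto simp: span_add om_simps)
  qed
qed

lemma root_om_int: "\<beta> \<in> R \<Longrightarrow> k \<in> D \<Longrightarrow> om k \<beta> \<in> \<int>"
  using P_cases[of \<beta>] P_span_om[of \<beta>] P_span_om[of "- \<beta>"] by (auto simp: om_simps)

lemma root_expand:
  assumes "v \<in> span R"
  shows "(\<Sum>k\<in>D. om k v *\<^sub>R k) = v"
proof -
  have "\<beta> \<in> span D" if "\<beta> \<in> R" for \<beta>
    using P_cases[OF that] P_span_om span_neg by fastforce
  then have "v \<in> span D"
    using assms by (metis span_mono span_span subsetD subsetI)
  moreover have "linear (\<lambda>v. \<Sum>k\<in>D. om k v *\<^sub>R k)"
    by (intro linearI) (simp_all add: om_simps algebra_simps sum.distrib scaleR_sum_right)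
  moreover have "(\<Sum>k\<in>D. om k j *\<^sub>R k) = j" if "j \<in> D" for j
  proof -
    have "(\<Sum>k\<in>D. om k j *\<^sub>R k) = (\<Sum>k\<in>D. if k = j then k else 0)"
      by (intro sum.cong) (auto simp: om_D that)
    then show ?thesis using that finite_D by simp
  qed
  ultimately show ?thesis
    using linear_eq_on_span[OF _ linear_id, of "\<lambda>v. \<Sum>k\<in>D. om k v *\<^sub>R k" D v] by simp
qed

lemma form_expand:
  assumes "u \<in> span R"
  shows "B v u = (\<Sum>k\<in>D. om k u * B v k)"
proof -
  have "B v u = B v (\<Sum>k\<in>D. om k u *\<^sub>R k)" using root_expand[OF assms] by simp
  then show ?thesis by (simp add: form_sum form_simps)
qed

lemma zero_if_om_zero: "v \<in> span R \<Longrightarrow> (\<And>k. k \<in> D \<Longrightarrow> om k v = 0) \<Longrightarrow> v = 0"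
  using root_expand[of v] by simp

text \<open>Expanding \<open>B u u > 0\<close> in simple coordinates leaves a positive summand. This
  choice of \<open>k\<close> drives the descents in \<open>lattice_norm_ge\<close>,
  \<open>positive_reflection_word\<close> and \<open>dominant_below_in_hull\<close>.\<close>

lemma exists_acute:
  assumes "u \<in> span R" "u \<noteq> 0" "\<And>k. k \<in> D \<Longrightarrow> om k u \<ge> 0"
  obtains k where "k \<in> D" "om k u > 0" "B u k > 0"
proof -
  have "\<not> (\<Sum>k\<in>D. om k u * B u k) \<le> 0"
    using form_expand[OF assms(1), of u] pos[OF assms(1,2)] by simp
  then obtain k where "k \<in> D" "om k u * B u k > 0"
    using sum_nonpos[of D "\<lambda>k. om k u * B u k"] by (meson not_le)
  then show thesis
    using that assms(3)[of k] by (auto simp: zero_less_mult_iff)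
qed

section \<open>The root lattice in simple coordinates\<close>

definition L where "L = {v \<in> span R. \<forall>k\<in>D. om k v \<in> \<int>}"

lemma L_diff: "u \<in> L \<Longrightarrow> v \<in> L \<Longrightarrow> u - v \<in> L"
  by (auto simp: L_def span_diff om_simps)

lemma root_L: "\<beta> \<in> R \<Longrightarrow> \<beta> \<in> L"
  by (auto simp: L_def span_base root_om_int)

lemma root_lattice_L: "root_lattice R \<subseteq> L"
  by (auto simp: root_lattice_def L_def linear_sum[OF om_linear] om_simps root_om_int
      intro!: Ints_sum Ints_mult) (intro span_sum span_scale span_base)

lemma coroot_L:
  assumes "v \<in> L" "\<beta> \<in> R"
  shows "coroot R \<beta> v \<in> \<int>"
proof -
  have v: "v \<in> span R" using assms by (simp add: L_def)
  have "coroot R \<beta> v = coroot R \<beta> (\<Sum>k\<in>D. om k v *\<^sub>R k)"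
    by (simp add: root_expand[OF v])
  also have "\<dots> = (\<Sum>k\<in>D. om k v * coroot R \<beta> k)"
    using coroot_linear[OF assms(2)] by (simp add: linear_sum linear_scale)
  also have "\<dots> \<in> \<int>"
    using assms coroot_int D_root by (auto simp: L_def intro!: Ints_sum Ints_mult)
  finally show ?thesis .
qed

lemma s_L: "v \<in> L \<Longrightarrow> \<beta> \<in> R \<Longrightarrow> s \<beta> v \<in> L"
  using coroot_L[of v \<beta>] root_L[of \<beta>]
  by (auto simp: reflection_def L_def om_simps span_diff span_scale)

lemma coroot_pos_iff: "\<beta> \<in> R \<Longrightarrow> v \<in> span R \<Longrightarrow> coroot R \<beta> v > 0 \<longleftrightarrow> B v \<beta> > 0"
  using root_pos[of \<beta>] by (simp add: coroot_eq zero_less_divide_iff)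

lemma coroot_ge_1:
  assumes "v \<in> L" "\<beta> \<in> R" "coroot R \<beta> v > 0"
  shows "coroot R \<beta> v \<ge> 1"
  using coroot_L[OF assms(1,2)] assms(3) by (auto elim!: Ints_cases)

text \<open>The coordinate total counts the simple roots still to be subtracted in the later
  descents.\<close>

lemma om_total_nat:
  assumes "v \<in> L" "\<And>k. k \<in> D \<Longrightarrow> om k v \<ge> 0"
  obtains n where "(\<Sum>k\<in>D. om k v) = real n"
proof -
  have "(\<Sum>k\<in>D. om k v) \<in> \<int>" "(\<Sum>k\<in>D. om k v) \<ge> 0"
    using assms by (auto simp: L_def intro!: Ints_sum sum_nonneg)
  then show thesis
    using that by (metis Ints_cases of_int_0_le_iff of_int_of_nat_eq zero_le_imp_eq_int)
qed

lemma om_total_diff: "k \<in> D \<Longrightarrow> (\<Sum>j\<in>D. om j (v - k)) = (\<Sum>j\<in>D. om j v) - 1"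
proof -
  assume "k \<in> D"
  have "(\<Sum>j\<in>D. om j (v - k)) = (\<Sum>j\<in>D. om j v) - (\<Sum>j\<in>D. if j = k then 1 else 0)"
    unfolding sum_subtractf[symmetric] using \<open>k \<in> D\<close>
    by (intro sum.cong) (auto simp: om_simps om_D)
  then show ?thesis using \<open>k \<in> D\<close> finite_D by simp
qed

lemma om_diff_nonneg:
  assumes "v \<in> L" "\<And>j. j \<in> D \<Longrightarrow> om j v \<ge> 0" "k \<in> D" "om k v > 0" "j \<in> D"
  shows "om j (v - k) \<ge> 0"
proof -
  have "om k v \<ge> 1"
    using assms by (auto simp: L_def elim!: Ints_cases[of "om k v"] dest!: bspec[of _ _ k])
  then show ?thesis using assms by (auto simp: om_simps om_D)
qed

text \<open>Subtracting a simple root \<open>k\<close> with \<open>B n k > 0\<close> does not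
  lengthen \<open>n\<close>: integrality gives \<open>coroot R k n \<ge> 1\<close>, hence
  \<open>B k k \<le> 2 * B n k\<close>. The descent ends at a simple root.\<close>

lemma lattice_norm_ge:
  assumes c: "\<And>k. k \<in> D \<Longrightarrow> c \<le> B k k"
    and n: "n \<in> L" "n \<noteq> 0" "\<And>k. k \<in> D \<Longrightarrow> om k n \<ge> 0"
  shows "c \<le> B n n"
proof -
  obtain N where "(\<Sum>k\<in>D. om k n) = real N" using om_total_nat n by blast
  then show ?thesis using n
  proof (induction N arbitrary: n)
    case 0
    then have "\<forall>k\<in>D. om k n = 0" using finite_D by (simp add: sum_nonneg_eq_0_iff)
    then show ?case using 0 zero_if_om_zero by (auto simp: L_def)
  next
    case (Suc N)
    have sp: "n \<in> span R" using Suc.prems by (simp add: L_def)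
    obtain k where k: "k \<in> D" "om k n > 0" "B n k > 0"
      using exists_acute[OF sp Suc.prems(3,4)] by blast
    have kR: "k \<in> R" using k D_root by simp
    show ?case
    proof (cases "n = k")
      case True
      then show ?thesis using c k by simp
    next
      case False
      have "coroot R k n \<ge> 1"
        using k kR sp Suc.prems coroot_ge_1 by (simp add: coroot_pos_iff)
      then have "B k k \<le> 2 * B n k"
        using coroot_form[OF kR sp] root_pos[OF kR]
        by (metis less_eq_real_def mult_1 mult_right_mono)
      then have "B (n - k) (n - k) \<le> B n n"
        by (simp add: form_simps sym[of k n])
      moreover have "c \<le> B (n - k) (n - k)"
      proof (rule Suc.IH)
        show "(\<Sum>j\<in>D. om j (n - k)) = real N"
          using Suc.prems om_total_diff k by simp
        show "om j (n - k) \<ge> 0" if "j \<in> D" for j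
          using om_diff_nonneg Suc.prems k that by blast
      qed (use False Suc.prems kR L_diff root_L in auto)
      ultimately show ?thesis by linarith
    qed
  qed
qed

text \<open>\<open>s j\<close> alters only the coordinate at \<open>j\<close>. If
  \<open>\<beta>\<close> became negative, its other coordinates would vanish, so
  \<open>\<beta>\<close> would be a multiple of \<open>j\<close>; integrality leaves the factors 1
  and 2, and reducedness excludes 2.\<close>

lemma simple_reflection_permutes:
  assumes j: "j \<in> D" and \<beta>: "\<beta> \<in> P" "\<beta> \<noteq> j"
  shows "s j \<beta> \<in> P"
proof (rule ccontr)
  assume "s j \<beta> \<notin> P"
  then have neg: "- s j \<beta> \<in> P" using P_cases s_root D_root P_root assms by blast
  have R: "\<beta> \<in> R" "j \<in> R" using assms P_root D_root by auto
  have "om k \<beta> = 0" if "k \<in> D" "k \<noteq> j" for k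
  proof -
    have "om k (s j \<beta>) = om k \<beta>" using that j by (simp add: reflection_def om_simps om_D)
    then show ?thesis using P_span_om[OF neg] P_span_om[OF \<beta>(1)] that by (force simp: om_simps)
  qed
  then have "(\<Sum>k\<in>D. om k \<beta> *\<^sub>R k) = (\<Sum>k\<in>D. if k = j then om k \<beta> *\<^sub>R k else 0)"
    by (intro sum.cong) auto
  then have \<beta>j: "\<beta> = om j \<beta> *\<^sub>R j"
    using root_expand[OF span_base[OF R(1)]] j finite_D by simp
  obtain a m :: int where am: "om j \<beta> = of_int a" "coroot R \<beta> j = of_int m"
    using root_om_int coroot_int R j by (meson Ints_cases)
  have "om j \<beta> * coroot R \<beta> j = 2"
    using coroot_self[OF R(1)] linear_scale[OF coroot_linear[OF R(1)], of "om j \<beta>" j] \<beta>j by simp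
  then have "real_of_int (a * m) = 2" using am by simp
  then have am2: "a * m = 2" by linarith
  have "a \<ge> 0" using P_span_om[OF \<beta>(1)] j am by force
  moreover have "a dvd 2" using am2 by (metis dvd_triv_left)
  then have "a \<le> 2" by (simp add: zdvd_imp_le)
  moreover have "a \<noteq> 0" using am2 by auto
  ultimately have "a = 1 \<or> a = 2" by linarith
  then show False
  proof
    assume "a = 1"
    then show False using \<beta>j am \<beta> by simp
  next
    assume "a = 2"
    then have "\<beta> = 2 *\<^sub>R j" using \<beta>j am by simp
    then have "(1/2) *\<^sub>R \<beta> = j" by simp
    then show False using red R by (auto simp: reduced_def)
  qed
qed

subsection \<open>Words in simple reflections\<close>

text \<open>Words make lengths available for induction; the last letter acts first.\<close>

definition act :: "'a list \<Rightarrow> 'a \<Rightarrow> 'a" where "act ws = foldr s ws"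

lemma act_simps [simp]: "act [] v = v" "act (k # ws) v = s k (act ws v)"
  "act (us @ ws) v = act us (act ws v)"
  by (auto simp: act_def)

lemma act_span: "ws \<in> lists D \<Longrightarrow> v \<in> span R \<Longrightarrow> act ws v \<in> span R"
  by (induction ws) (auto intro: s_span D_root)

lemma act_root: "ws \<in> lists D \<Longrightarrow> \<beta> \<in> R \<Longrightarrow> act ws \<beta> \<in> R"
  by (induction ws) (auto intro: s_root D_root)

lemma act_diff_scale: "ws \<in> lists D \<Longrightarrow> act ws (u - c *\<^sub>R v) = act ws u - c *\<^sub>R act ws v"
  by (induction ws) (auto simp: linear_diff linear_scale s_linear D_root)

lemma act_rev: "ws \<in> lists D \<Longrightarrow> act (rev ws) (act ws v) = v"
  by (induction ws arbitrary: v) (auto simp: s_s D_root)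

lemma act_conj:
  assumes "ws \<in> lists D" "\<beta> \<in> R" "v \<in> span R"
  shows "s (act ws \<beta>) (act ws v) = act ws (s \<beta> v)"
  using assms
  by (induction ws) (auto simp: s_conj act_root act_span D_root)

text \<open>Conjugating by a simple \<open>k\<close> that pairs positively with
  \<open>\<beta>\<close> replaces \<open>\<beta>\<close> by the positive root
  \<open>s k \<beta>\<close>, on which \<open>\<phi>\<close> is smaller.\<close>

lemma positive_reflection_word:
  "\<beta> \<in> P \<Longrightarrow> \<exists>ws\<in>lists D. \<forall>v\<in>span R. s \<beta> v = act ws v"
proof (induction rule: P_less_induct)
  case (less \<beta>)
  show ?case
  proof (cases "\<beta> \<in> D")
    case True
    then show ?thesis by (intro bexI[of _ "[\<beta>]"]) auto
  next
    case False
    have R: "\<beta> \<in> R" "\<beta> \<in> span R" using less.hyps by (auto simp: P_root span_base)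
    obtain k where k: "k \<in> D" "om k \<beta> > 0" "B \<beta> k > 0"
      using exists_acute[OF R(2) root_nonzero[OF R(1)]] P_span_om[OF less.hyps] by blast
    have kR: "k \<in> R" using k D_root by simp
    have \<gamma>: "s k \<beta> \<in> P"
      using simple_reflection_permutes k less.hyps False by metis
    have "coroot R k \<beta> * \<phi> k > 0"
      using k coroot_pos_iff kR R D_P by (simp add: P_def)
    then have "\<phi> (s k \<beta>) < \<phi> \<beta>"
      by (simp add: reflection_def linear_diff[OF \<phi>_linear] linear_scale[OF \<phi>_linear])
    then obtain ws where ws: "ws \<in> lists D" "\<And>v. v \<in> span R \<Longrightarrow> s (s k \<beta>) v = act ws v"
      using less.IH \<gamma> by blast
    have "s \<beta> v = act (k # ws @ [k]) v" if "v \<in> span R" for v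
    proof -
      have "s (s k (s k \<beta>)) (s k (s k v)) = s k (s (s k \<beta>) (s k v))"
        using s_conj P_root[OF \<gamma>] kR s_span that by blast
      then show ?thesis using ws s_s s_span kR that by simp
    qed
    then show ?thesis using ws k by (intro bexI[of _ "k # ws @ [k]"]) auto
  qed
qed

lemma reflection_word:
  assumes "\<beta> \<in> R"
  shows "\<exists>ws\<in>lists D. \<forall>v\<in>span R. s \<beta> v = act ws v"
proof -
  have "s (- \<beta>) v = s \<beta> v" if "v \<in> span R" for v
    using that assms by (simp add: reflection_def coroot_eq neg_root form_simps)
  then show ?thesis
    using P_cases[OF assms] positive_reflection_word by metis
qed

lemma weyl_word:
  "w \<in> weyl_group R \<Longrightarrow> \<exists>ws\<in>lists D. \<forall>v\<in>span R. w v = act ws v"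
proof (induction rule: weyl_group.induct)
  case 1
  then show ?case by (intro bexI[of _ "[]"]) auto
next
  case (2 \<beta> w)
  then obtain ws us where "ws \<in> lists D" "\<forall>v\<in>span R. w v = act ws v"
    "us \<in> lists D" "\<forall>v\<in>span R. s \<beta> v = act us v"
    using reflection_word by metis
  then show ?case by (intro bexI[of _ "us @ ws"]) (auto simp: act_span)
qed

text \<open>
  Let \<open>j # us\<close> be the shortest suffix of \<open>ws\<close> that sends \<open>k\<close> out of \<open>P\<close>. Then \<open>act us k = j\<close>, so \<open>s j\<close> is
  the conjugate of \<open>s k\<close> by \<open>act us\<close>, and the letter \<open>j\<close> can be deleted together with \<open>s k\<close>.
\<close>

lemma exchange:
  assumes "ws \<in> lists D" "k \<in> D" "act ws k \<notin> P"
  shows "\<exists>us\<in>lists D. length us < length ws \<and> (\<forall>v\<in>span R. act ws (s k v) = act us v)"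
  using assms
proof (induction ws)
  case Nil
  then show ?case using D_P by simp
next
  case (Cons j ws)
  show ?case
  proof (cases "act ws k \<in> P")
    case True
    then have "act ws k = j" using simple_reflection_permutes[of j "act ws k"] Cons by auto
    then have "act (j # ws) (s k v) = act ws v" if "v \<in> span R" for v
      using act_conj[of ws k v, symmetric] Cons.hyps assms(2) D_root s_s that by simp
    then show ?thesis using Cons by (intro bexI[of _ ws]) auto
  next
    case False
    then obtain us where "us \<in> lists D" "length us < length ws"
      "\<forall>v\<in>span R. act ws (s k v) = act us v"
      using Cons by auto
    then show ?thesis using Cons by (intro bexI[of _ "j # us"]) auto
  qed
qed

text \<open>Let \<open>j\<close> be the last letter of the word. If the rest sends \<open>j\<close>
  to a positive root, then by dominance \<open>j\<close> only causes a nonnegative multiple of that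
  root to be subtracted; otherwise \<open>exchange\<close> shortens the word.\<close>

lemma dominant_maximal:
  assumes "ws \<in> lists D" "v \<in> span R" "dominant v" "k \<in> D"
  shows "om k (act ws v) \<le> om k v"
  using assms(1)
proof (induction "length ws" arbitrary: ws rule: less_induct)
  case less
  show ?case
  proof (cases ws rule: rev_cases)
    case Nil
    then show ?thesis by simp
  next
    case (snoc us j)
    then have us: "us \<in> lists D" "j \<in> D" using less.prems by auto
    show ?thesis
    proof (cases "act us j \<in> P")
      case True
      have "act ws v = act us v - coroot R j v *\<^sub>R act us j"
        using snoc us by (simp add: act_diff_scale reflection_def)
      moreover have "coroot R j v * om k (act us j) \<ge> 0"
        using assms(3,4) us P_span_om[OF True] by (simp add: dominant_def)
      moreover have "om k (act us v) \<le> om k v"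
        using less.hyps snoc us by simp
      ultimately show ?thesis by (simp add: om_simps)
    next
      case False
      then obtain us' where "us' \<in> lists D" "length us' < length us"
        "act us (s j v) = act us' v"
        using exchange us assms(2) by blast
      then show ?thesis using less.hyps[of us'] snoc by simp
    qed
  qed
qed

subsection \<open>Convex hulls of orbits\<close>

lemma orbit_reflection: "\<beta> \<in> R \<Longrightarrow> v \<in> weyl_orbit R x \<Longrightarrow> s \<beta> v \<in> weyl_orbit R x"
  unfolding weyl_orbit_def
  by clarify (metis comp_apply weyl_group.intros(2))

lemma hull_reflection:
  assumes "\<beta> \<in> R" "v \<in> convex hull (weyl_orbit R x)"
  shows "s \<beta> v \<in> convex hull (weyl_orbit R x)"
proof -
  have "s \<beta> v \<in> convex hull (s \<beta> ` weyl_orbit R x)"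
    using assms convex_hull_linear_image[OF s_linear, of \<beta>] by blast
  then show ?thesis
    using hull_mono[of "s \<beta> ` weyl_orbit R x"] orbit_reflection assms by blast
qed

lemma weyl_group_linear: "w \<in> weyl_group R \<Longrightarrow> linear w \<and> w ` R \<subseteq> R"
proof (induction rule: weyl_group.induct)
  case (2 \<beta> w)
  then show ?case using s_linear s_root linear_compose[of w "s \<beta>"] by (auto simp: o_def)
next
  case 1
  then show ?case using linear_id unfolding id_def by auto
qed

text \<open>With one expression of \<open>x\<close> in roots fixed, \<open>w x\<close> depends only
  on the restriction of \<open>w\<close> to a map from \<open>R\<close> to \<open>R\<close>, even if
  the group is infinite on the ambient space.\<close>

lemma finite_orbit:
  assumes "x \<in> root_lattice R"
  shows "finite (weyl_orbit R x)"
proof -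
  obtain c :: "'a \<Rightarrow> int" where x: "x = (\<Sum>\<alpha>\<in>R. of_int (c \<alpha>) *\<^sub>R \<alpha>)"
    using assms by (auto simp: root_lattice_def)
  have "weyl_orbit R x \<subseteq> (\<lambda>f. \<Sum>\<alpha>\<in>R. of_int (c \<alpha>) *\<^sub>R f \<alpha>) ` (R \<rightarrow>\<^sub>E R)"
  proof
    fix u assume "u \<in> weyl_orbit R x"
    then obtain w where w: "w \<in> weyl_group R" "u = w x" by (auto simp: weyl_orbit_def)
    then have "u = (\<Sum>\<alpha>\<in>R. of_int (c \<alpha>) *\<^sub>R restrict w R \<alpha>)"
      using weyl_group_linear[OF w(1)] by (simp add: x linear_sum linear_scale)
    moreover have "restrict w R \<in> R \<rightarrow>\<^sub>E R"
      using weyl_group_linear[OF w(1)] by auto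
    ultimately show "u \<in> (\<lambda>f. \<Sum>\<alpha>\<in>R. of_int (c \<alpha>) *\<^sub>R f \<alpha>) ` (R \<rightarrow>\<^sub>E R)" by blast
  qed
  then show ?thesis
    using finite_roots by (meson finite_PiE finite_imageI finite_subset)
qed

text \<open>A point of the orbit maximizing \<open>\<phi>\<close> is dominant, since no simple
  reflection can raise its value.\<close>

lemma orbit_dominant_exists:
  assumes "x \<in> root_lattice R"
  obtains X where "X \<in> weyl_orbit R x" "dominant X"
proof -
  let ?O = "weyl_orbit R x"
  have "x \<in> ?O" unfolding weyl_orbit_def using weyl_group.intros(1)[of R] by (metis (mono_tags) id_apply mem_Collect_eq)
  then have "Max (\<phi> ` ?O) \<in> \<phi> ` ?O"
    using finite_orbit[OF assms] by (intro Max_in) auto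
  then obtain X where X: "X \<in> ?O" "\<phi> X = Max (\<phi> ` ?O)" by auto
  have "coroot R k X \<ge> 0" if "k \<in> D" for k
  proof -
    have "\<phi> (s k X) \<le> \<phi> X"
      using X orbit_reflection D_root that finite_orbit[OF assms] by simp
    then have "coroot R k X * \<phi> k \<ge> 0"
      by (simp add: reflection_def linear_diff[OF \<phi>_linear] linear_scale[OF \<phi>_linear])
    then show ?thesis using D_P[OF that] by (simp add: P_def zero_le_mult_iff)
  qed
  then show thesis using that X by (simp add: dominant_def)
qed

text \<open>Every orbit point is a word applied to \<open>X\<close>, so
  \<open>dominant_maximal\<close> bounds it, and the bound passes to the hull because it defines a
  convex set.\<close>

lemma hull_below_dominant:
  assumes x: "x \<in> span R" and X: "X \<in> weyl_orbit R x" "dominant X"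
    and y: "y \<in> convex hull (weyl_orbit R x)" and k: "k \<in> D"
  shows "om k y \<le> om k X"
proof -
  obtain w where w: "w \<in> weyl_group R" "X = w x"
    using X by (auto simp: weyl_orbit_def)
  then obtain ws where ws: "ws \<in> lists D" "X = act ws x"
    using weyl_word x by blast
  have "om k u \<le> om k X" if "u \<in> weyl_orbit R x" for u
  proof -
    obtain us where us: "us \<in> lists D" "u = act us x"
    proof -
      obtain w' where "w' \<in> weyl_group R" "u = w' x"
        using \<open>u \<in> weyl_orbit R x\<close> by (auto simp: weyl_orbit_def)
      then show thesis using that weyl_word x by blast
    qed
    have "u = act (us @ rev ws) X" using us ws act_rev by simp
    moreover have "us @ rev ws \<in> lists D" using us ws by auto
    ultimately show ?thesis
      using dominant_maximal X(2) k act_span ws x by metis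
  qed
  moreover have "convex {u. om k u \<le> om k X}"
    by (intro convexI) (auto simp: om_simps intro: convex_bound_le)
  ultimately show ?thesis
    using hull_minimal[of "weyl_orbit R x" "{u. om k u \<le> om k X}" convex] y by blast
qed

text \<open>
  While \<open>v \<noteq> z\<close>, some simple root \<open>k\<close> can be subtracted from \<open>v\<close> without leaving the hull: the pairing of
  \<open>v\<close> with the coroot of \<open>k\<close> is at least \<open>1\<close>, so that \<open>v - k\<close> lies between \<open>v\<close> and \<open>s k v\<close>.
\<close>

lemma dominant_below_in_hull:
  assumes z: "z \<in> L" "dominant z"
    and v: "v \<in> L" "v \<in> convex hull (weyl_orbit R x)" "\<And>k. k \<in> D \<Longrightarrow> om k z \<le> om k v"
  shows "z \<in> convex hull (weyl_orbit R x)"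
proof -
  have ge: "om k (v - z) \<ge> 0" if "k \<in> D" for k using v that by (simp add: om_simps)
  obtain N where "(\<Sum>k\<in>D. om k (v - z)) = real N"
    using om_total_nat[OF L_diff ge] v z by blast
  then show ?thesis using v(1,2) ge
  proof (induction N arbitrary: v)
    case 0
    then have "\<forall>k\<in>D. om k (v - z) = 0" using finite_D by (simp add: sum_nonneg_eq_0_iff)
    then have "v - z = 0"
      using 0 z L_diff[of v z] zero_if_om_zero[of "v - z"] by (auto simp: L_def)
    then show ?case using 0 by simp
  next
    case (Suc N)
    let ?C = "convex hull (weyl_orbit R x)"
    have vz: "v - z \<in> L" "v - z \<in> span R" using Suc.prems z L_diff by (auto simp: L_def)
    have "v - z \<noteq> 0" using Suc.prems(1) by (auto simp: om_simps)
    then obtain k where k: "k \<in> D" "om k (v - z) > 0" "B (v - z) k > 0"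
      using exists_acute[OF vz(2)] Suc.prems(4) by blast
    have kR: "k \<in> R" using k D_root by simp
    define t where "t = coroot R k v"
    \<comment> \<open>The coroot of \<open>k\<close> is positive on \<open>v - z\<close> and
      nonnegative on \<open>z\<close>, hence positive on \<open>v\<close>; integrality on
      \<open>L\<close> then gives \<open>t \<ge> 1\<close>.\<close>
    have "coroot R k (v - z) > 0"
      using k kR vz by (simp add: coroot_pos_iff)
    then have "coroot R k v > 0"
      using z(2) k(1) by (auto simp: dominant_def linear_diff[OF coroot_linear[OF kR]])
    then have t: "t \<ge> 1" using coroot_ge_1 Suc.prems kR t_def by simp
    have "(1 - 1/t) *\<^sub>R v + (1/t) *\<^sub>R s k v \<in> ?C"
      using t Suc.prems hull_reflection kR by (intro convexD[OF convex_convex_hull]) auto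
    moreover have "(1 - 1/t) *\<^sub>R v + (1/t) *\<^sub>R s k v = v - k"
      using t by (simp add: reflection_def t_def[symmetric] algebra_simps)
    ultimately have "v - k \<in> ?C" by simp
    moreover have "v - k \<in> L" using Suc.prems kR L_diff root_L by blast
    moreover have eq: "v - k - z = (v - z) - k" by simp
    moreover have "(\<Sum>j\<in>D. om j (v - k - z)) = real N"
      unfolding eq using om_total_diff[OF k(1)] Suc.prems by simp
    moreover have "om j (v - k - z) \<ge> 0" if "j \<in> D" for j
      unfolding eq using om_diff_nonneg[OF vz(1) Suc.prems(4) k(1,2) that] by simp
    ultimately show ?case using Suc.IH by blast
  qed
qed

lemma dominant_form: "dominant v \<Longrightarrow> v \<in> span R \<Longrightarrow> k \<in> D \<Longrightarrow> B v k \<ge> 0"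
  using coroot_form[of k v] root_pos[of k] D_root[of k]
  by (auto simp: dominant_def dest!: bspec[of _ _ k])
    (metis mult_nonneg_nonneg less_eq_real_def zero_le_mult_iff zero_less_numeral not_le)

lemma dominant_midpoint_in_hull:
  assumes irr: "irreducible_root_system R" and x: "x \<in> root_lattice R"
    and \<alpha>: "\<alpha> \<in> P" "coroot R \<alpha> y = 0"
    and y: "y \<in> convex hull (weyl_orbit R x)"
    and z: "z = y + (1/2) *\<^sub>R \<alpha>" "z \<in> root_lattice R" "dominant z"
  shows "z \<in> convex hull (weyl_orbit R x)"
proof -
  have xL: "x \<in> L" and zL: "z \<in> L" using root_lattice_L x z by auto
  have \<alpha>R: "\<alpha> \<in> R" "\<alpha> \<in> span R" using P_root \<alpha> span_base by auto
  obtain X where X: "X \<in> weyl_orbit R x" "dominant X"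
    using orbit_dominant_exists x by blast
  have "w x \<in> L" if "w \<in> weyl_group R" for w
    using that by induction (auto simp: xL s_L)
  then have XL: "X \<in> L" using X by (auto simp: weyl_orbit_def)
  have span: "x \<in> span R" "X \<in> span R" "z \<in> span R" using xL XL zL by (auto simp: L_def)
  have "coroot R \<alpha> z = 1"
    using z(1) \<alpha>(2) coroot_self[OF \<alpha>R(1)] coroot_linear[OF \<alpha>R(1)]
    by (simp add: linear_add linear_scale)
  then have B\<alpha>: "2 * B z \<alpha> = B \<alpha> \<alpha>" using coroot_form[OF \<alpha>R(1) span(3)] by simp
  define c where "c k = om k (X - z)" for k
  define p where "p = (\<Sum>k\<in>D. max 0 (c k) *\<^sub>R k)"
  define n where "n = (\<Sum>k\<in>D. max 0 (- c k) *\<^sub>R k)"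
  have pn: "p - n = X - z"
    unfolding p_def n_def parts_diff using root_expand[OF span_diff[OF span(2,3)]]
    by (simp add: c_def)
  \<comment> \<open>\<open>z\<close> exceeds \<open>y\<close> by half of \<open>\<alpha>\<close>,
    and \<open>y\<close> lies coordinatewise below \<open>X\<close>.\<close>
  have c: "max 0 (- c k) \<le> om k \<alpha> / 2" if "k \<in> D" for k
    using hull_below_dominant[OF span(1) X y that] P_span_om[OF \<alpha>(1)] that z(1)
    by (auto simp: c_def om_simps max_def)
  have om_n: "om k n = max 0 (- c k)" if "k \<in> D" for k
    unfolding n_def by (rule om_sum[OF that])
  have cZ: "c k \<in> \<int>" if "k \<in> D" for k
    using L_diff[OF XL zL] that by (simp add: c_def L_def)
  have nL: "n \<in> L"
    using om_n cZ sum_D_span by (auto simp: L_def n_def max_def)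
  have "B X n \<ge> 0"
    unfolding n_def using dominant_form[OF X(2) span(2)]
    by (auto simp: form_sum form_simps intro!: sum_nonneg)
  moreover have "B p n \<le> 0"
    unfolding p_def n_def by (rule form_parts_nonpos)
  moreover have "B n n = B p n - B X n + B z n"
  proof -
    have "n = p - X + z" using pn by (simp add: algebra_simps)
    then have "B n n = B (p - X + z) n" by simp
    then show ?thesis by (simp add: form_simps)
  qed
  moreover have "B z n \<le> (\<Sum>k\<in>D. om k \<alpha> / 2 * B z k)"
  proof -
    have "B z n = (\<Sum>k\<in>D. max 0 (- c k) * B z k)"
      by (simp add: n_def form_sum form_simps)
    also have "\<dots> \<le> (\<Sum>k\<in>D. om k \<alpha> / 2 * B z k)"
      by (intro sum_mono mult_right_mono c dominant_form[OF z(3) span(3)])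
    finally show ?thesis .
  qed
  moreover have "(\<Sum>k\<in>D. om k \<alpha> / 2 * B z k) = B z \<alpha> / 2"
    using form_expand[OF \<alpha>R(2)] by (simp add: sum_divide_distrib)
  ultimately have upper: "B n n \<le> B \<alpha> \<alpha> / 4" using B\<alpha> by linarith
  have "n = 0"
  proof (rule ccontr)
    assume "n \<noteq> 0"
    \<comment> \<open>This lower bound carries over to \<open>n\<close>, where its factor 1/3
      contradicts the factor 1/4 in \<open>upper\<close>.\<close>
    have "B \<alpha> \<alpha> / 3 \<le> B k k" if "k \<in> D" for k
      using root_length_ratio[OF irr red \<alpha>R(1) D_root[OF that]] by simp
    then have "B \<alpha> \<alpha> / 3 \<le> B n n"
      by (rule lattice_norm_ge[OF _ nL \<open>n \<noteq> 0\<close>]) (simp_all add: om_n)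
    then show False using upper root_pos[OF \<alpha>R(1)] by linarith
  qed
  then have "om k z \<le> om k X" if "k \<in> D" for k
    using om_n[OF that] by (simp add: om_simps c_def max_def split: if_splits)
  then show ?thesis
    using dominant_below_in_hull[OF zL z(3) XL hull_inc[OF X(1)]] by blast
qed

end

theorem theorem2p1:
  fixes R :: "'a::real_vector set" and x y z \<alpha> :: 'a
  assumes "irreducible_root_system R"
    and "reduced R"
    and "x \<in> root_lattice R"
    and "\<alpha> \<in> R"
    and "y \<in> convex hull (weyl_orbit R x)"
    and "coroot R \<alpha> y = 0"
    and "z = y + (1/2) *\<^sub>R \<alpha>"
    and "z \<in> root_lattice R"
  shows "z \<in> convex hull (weyl_orbit R x)"
proof -
  have rs: "root_system R"
    using assms(1) by (simp add: irreducible_root_system_def)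
  obtain B where B: "root_form R B"
    using invariant_form_exists[OF rs] rs unfolding root_form_def by metis
  interpret root_form R B by (rule B)
  have zs: "z \<in> span R"
    using assms(8) unfolding root_lattice_def by clarify (intro span_sum span_scale span_base)
  have "\<exists>f :: 'a \<Rightarrow> real. linear f \<and> f \<beta> \<noteq> 0" if "\<beta> \<in> R" for \<beta>
    using coroot_linear[OF that] coroot_self[OF that] by (intro exI[of _ "coroot R \<beta>"]) auto
  \<comment> \<open>Perturbing \<open>B z\<close> keeps every root that pairs positively with
    \<open>z\<close> positive; this makes \<open>\<alpha>\<close> positive and \<open>z\<close>
    dominant.\<close>
  then obtain \<phi> :: "'a \<Rightarrow> real" where \<phi>: "linear \<phi>" "\<And>\<beta>. \<beta> \<in> R \<Longrightarrow> \<phi> \<beta> \<noteq> 0"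
    "\<And>\<beta>. \<beta> \<in> R \<Longrightarrow> B z \<beta> > 0 \<Longrightarrow> \<phi> \<beta> > 0"
    using generic_functional[OF finite_roots lin, of z] by blast
  interpret simple_system R B \<phi>
    by (intro simple_system.intro simple_system_axioms.intro B \<phi>(1,2) assms(2))
  have "coroot R \<alpha> z = 1"
    using assms coroot_self[OF assms(4)] coroot_linear[OF assms(4)]
    by (simp add: linear_add linear_scale)
  then have "\<alpha> \<in> P"
    using \<phi>(3) assms(4) coroot_pos_iff[OF assms(4) zs] by (simp add: P_def)
  moreover have "dominant z"
    unfolding dominant_def
  proof (rule ballI, rule ccontr)
    fix k assume k: "k \<in> D" and "\<not> 0 \<le> coroot R k z"
    then have "B z (- k) > 0"
      using root_pos[OF D_root[OF k]] coroot_form[OF D_root[OF k] zs]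
      by (simp add: form_simps) (metis mult_neg_pos not_le mult_less_0_iff zero_less_numeral not_less_iff_gr_or_eq)
    then have "- k \<in> P"
      using \<phi>(3) neg_root[OF D_root[OF k]] by (simp add: P_def)
    then show False using P_neg D_P[OF k] by blast
  qed
  ultimately show ?thesis
    using dominant_midpoint_in_hull assms by blast
qed

end
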